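(* There exists a constant $c>0$ such that for every sufficiently large $n$ there is an $n$-node radio network $G=(V,E)$ (with $|V|=n$) of radius $2$ with the following property: for every $k\ge 1$, every algorithm that solves the $k$-message broadcast problem on $G$ (in the worst case over the initial placement of the $k$ messages at nodes of $G$) needs at least $c\,k\log n$ rounds. In other words, the broadcast throughput achievable on $G$ is $O(1/\log n)$ messages per round, regardless of the algorithm.
   Context: Radio network model: the network is an undirected graph $G=(V,E)$ with $|V|=n$. Execution proceeds in synchronous rounds. In each round, each node either transmits a packet of $B=\Omega(\log n)$ bits or listens. A node receives a packet in a round if and only if it is listening and exactly one of its neighbors transmits in that round (in which case it receives that neighbor's packet); otherwise it receives nothing. The $k$-message broadcast problem: $k$ messages, each consisting of $\Theta(B)$ bits, are initially placed at an arbitrary subset of the nodes, and the goal is to deliver all $k$ messages to all nodes. Transmitted packets are not required to be one of the messages: the algorithm may be arbitrary, e.g. a network-coding algorithm in which each transmitted packet is a combination of several messages. *)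

theory Defs
  imports "HOL-Probability.Probability" "HOL-Library.Landau_Symbols" "HOL-Library.Extended_Nat"
begin

definition radio_network :: "'v set \<Rightarrow> ('v \<times> 'v) set \<Rightarrow> bool" where
  "radio_network V E \<longleftrightarrow> finite V \<and> E \<subseteq> V \<times> V \<and> sym E \<and> irrefl E"

text \<open>Distances are extended naturals, with value \<^term>\<open>\<infinity>\<close> between different components;
  so a graph of finite radius is connected.\<close>

definition graph_dist :: "('v \<times> 'v) set \<Rightarrow> 'v \<Rightarrow> 'v \<Rightarrow> enat" where
  "graph_dist E u v = (INF d \<in> {d. (u, v) \<in> E ^^ d}. enat d)"

definition eccentricity :: "'v set \<Rightarrow> ('v \<times> 'v) set \<Rightarrow> 'v \<Rightarrow> enat" where
  "eccentricity V E u = (SUP v \<in> V. graph_dist E u v)"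

definition graph_radius :: "'v set \<Rightarrow> ('v \<times> 'v) set \<Rightarrow> enat" where
  "graph_radius V E = (INF u \<in> V. eccentricity V E u)"

type_synonym bits = "bool list"

text \<open>What a node knows: its identity, the messages it holds initially (by message index), and
  what it received in each past round, in chronological order (\<^term>\<open>None\<close> for a round in which it
  received nothing). Its own past transmissions are determined by these data.\<close>

type_synonym 'v view = "'v \<times> (nat \<Rightarrow> bits option) \<times> bits option list"

text \<open>A deterministic algorithm: in each round a node transmits the packet \<open>p\<close> if \<open>action\<close>
  returns \<^term>\<open>Some p\<close> and listens if it returns \<^term>\<open>None\<close>; \<open>decode\<close> is the list of all messages
  as reconstructed from the view of the node. Both are arbitrary functions; as an algorithm is
  chosen for a given network, it may use full knowledge of the topology.\<close>

record 'v algorithm =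
  action :: "'v view \<Rightarrow> bits option"
  decode :: "'v view \<Rightarrow> bits list"

definition packet_size :: "nat \<Rightarrow> 'v algorithm \<Rightarrow> bool" where
  "packet_size B A \<longleftrightarrow> (\<forall>w p. action A w = Some p \<longrightarrow> length p = B)"

definition receives :: "('v \<times> 'v) set \<Rightarrow> ('v \<Rightarrow> bits option) \<Rightarrow> 'v \<Rightarrow> bits option" where
  "receives E a v =
    (if a v = None \<and> (\<exists>!u. (u, v) \<in> E \<and> a u \<noteq> None)
     then a (THE u. (u, v) \<in> E \<and> a u \<noteq> None) else None)"

text \<open>Message \<open>i\<close> of the list \<open>ms\<close> is initially placed at the node \<open>pl i\<close>.\<close>

definition initial_messages :: "(nat \<Rightarrow> 'v) \<Rightarrow> bits list \<Rightarrow> 'v \<Rightarrow> nat \<Rightarrow> bits option" where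
  "initial_messages pl ms v = (\<lambda>i. if i < length ms \<and> pl i = v then Some (ms ! i) else None)"

primrec history ::
  "('v \<times> 'v) set \<Rightarrow> 'v algorithm \<Rightarrow> (nat \<Rightarrow> 'v) \<Rightarrow> bits list \<Rightarrow> nat \<Rightarrow> 'v \<Rightarrow> bits option list" where
  "history E A pl ms 0 = (\<lambda>v. [])"
| "history E A pl ms (Suc t) = (\<lambda>v. history E A pl ms t v @
     [receives E (\<lambda>u. action A (u, initial_messages pl ms u, history E A pl ms t u)) v])"

definition delivers ::
  "'v set \<Rightarrow> ('v \<times> 'v) set \<Rightarrow> nat \<Rightarrow> 'v algorithm \<Rightarrow> (nat \<Rightarrow> 'v) \<Rightarrow> bits list \<Rightarrow> bool" where
  "delivers V E T A pl ms \<longleftrightarrow>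
    (\<forall>v\<in>V. decode A (v, initial_messages pl ms v, history E A pl ms T v) = ms)"

definition message_lists :: "nat \<Rightarrow> nat \<Rightarrow> bits list set" where
  "message_lists k b = {ms. length ms = k \<and> (\<forall>m\<in>set ms. length m = b)}"

text \<open>A general, possibly randomized algorithm is a probability measure on deterministic ones
  (nodes may thus even share randomness). It solves \<open>k\<close>-message broadcast in \<open>T\<close> rounds if, for
  each placement and all message contents, it delivers all messages to all nodes within \<open>T\<close> rounds
  with probability at least \<open>1/2\<close>; by Markov's inequality an algorithm with expected running time
  at most \<open>T / 2\<close> is included, and so is one that is always correct. A set that is not measurable
  has \<^const>\<open>measure\<close> 0, so measurability of the success event is implied.\<close>

definition solves_broadcast ::
  "'v set \<Rightarrow> ('v \<times> 'v) set \<Rightarrow> nat \<Rightarrow> nat \<Rightarrow> nat \<Rightarrow> nat \<Rightarrow> 'v algorithm measure \<Rightarrow> bool" where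
  "solves_broadcast V E B b k T M \<longleftrightarrow>
    prob_space M \<and> (\<forall>A\<in>space M. packet_size B A) \<and>
    (\<forall>pl\<in>{..<k} \<rightarrow> V. \<forall>ms\<in>message_lists k b.
       measure M {A \<in> space M. delivers V E T A pl ms} \<ge> 1/2)"

lemma deterministic_solves_broadcast:
  assumes "packet_size B A"
    and "\<And>pl ms. pl \<in> {..<k} \<rightarrow> V \<Longrightarrow> ms \<in> message_lists k b \<Longrightarrow> delivers V E T A pl ms"
  shows "solves_broadcast V E B b k T (return (count_space {A}) A)"
  unfolding solves_broadcast_def
proof (intro conjI ballI)
  show P: "prob_space (return (count_space {A}) A)"
    by (rule prob_space_return) simp
  show "packet_size B A'" if "A' \<in> space (return (count_space {A}) A)" for A'
    using that assms(1) by simp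
  fix pl ms assume "pl \<in> {..<k} \<rightarrow> V" "ms \<in> message_lists k b"
  then have "{A' \<in> space (return (count_space {A}) A). delivers V E T A' pl ms}
      = space (return (count_space {A}) A)"
    using assms(2) by auto
  then show "measure (return (count_space {A}) A)
      {A' \<in> space (return (count_space {A}) A). delivers V E T A' pl ms} \<ge> 1/2"
    using prob_space.prob_space[OF P] by simp
qed

end

theory Submission
  imports Defs "HOL-Number_Theory.Cong"
begin

text \<open>
  The network has a source, a middle layer of \<open>2 ^ d\<close> nodes with \<open>d\<close> of order \<open>ln n\<close>, and leaves
  that hear only the middle layer. There are equally many leaves on each of \<open>d\<close> scales; a leaf of
  scale \<open>i\<close> is adjacent to the nodes selected with density \<open>1 / 2 ^ i\<close> by a hash function from a
  pairwise independent family. If \<open>S\<close> is the set of transmitting middle nodes and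
  \<open>\<mu> = |S| / 2 ^ i\<close>, then by the first two moments the fraction of leaves of scale \<open>i\<close> with
  exactly one neighbour in \<open>S\<close> is at most \<open>min \<mu> (4 / \<mu>)\<close>. Summed over the scales this is \<open>O(1)\<close>,
  so in every round only a fraction \<open>O(1 / d)\<close> of all leaves receives a packet.

  Place all messages at the source. Silence may carry information too, so histories of a leaf are
  counted with weight \<open>x\<close> per reception; the total weight of all histories of length \<open>T\<close> is
  \<open>(1 + 2 ^ B * x) ^ T\<close>. Messages that are decoded correctly have distinct histories at each leaf,
  while by convexity the average weight over the leaves is at least \<open>x powr (O(T / d))\<close>.
  With \<open>x = 1 / (2 ^ B * d)\<close> this yields \<open>b * k \<le> O(B * T / d)\<close>.
\<close>

section \<open>Pairwise independent hashing\<close>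

lemma sum_periodic_shift:
  fixes G :: "int \<Rightarrow> real"
  assumes "q > 0" and per: "\<And>z. G (z mod q) = G z"
  shows "(\<Sum>a\<in>{0..<q}. G (a + c)) = (\<Sum>a\<in>{0..<q}. G a)"
proof -
  have bij: "bij_betw (\<lambda>a. (a + c) mod q) {0..<q} {0..<q}"
  proof (rule bij_betw_byWitness[where f' = "\<lambda>a. (a - c) mod q"])
    show "\<forall>a\<in>{0..<q}. ((a + c) mod q - c) mod q = a"
      by (auto simp: mod_diff_left_eq)
    show "\<forall>a\<in>{0..<q}. ((a - c) mod q + c) mod q = a"
      by (auto simp: mod_add_left_eq)
  qed (use \<open>q > 0\<close> in auto)
  have "(\<Sum>a\<in>{0..<q}. G (a + c)) = (\<Sum>a\<in>{0..<q}. G ((a + c) mod q))"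
    by (simp add: per)
  also have "\<dots> = (\<Sum>a\<in>{0..<q}. G a)"
    by (rule sum.reindex_bij_betw[OF bij])
  finally show ?thesis .
qed

section \<open>Equidistribution over arcs of residues\<close>

definition arc :: "int \<Rightarrow> int \<Rightarrow> int \<Rightarrow> real" where
  "arc q s z = of_bool (z mod q < s)"

lemma arc_mod [simp]: "arc q s (z mod q) = arc q s z"
  by (simp add: arc_def)

text \<open>A point lies in the arc iff its quotient by \<open>s\<close> is divisible by
  \<open>r\<close>. Each shift by \<open>s\<close> raises that quotient by one, and exactly one of
  \<open>r\<close> consecutive integers is divisible by \<open>r\<close>.\<close>

lemma arc_tiling:
  fixes s r z :: int
  assumes "s > 0" "r > 0"
  shows "(\<Sum>y\<in>{0..<r}. arc (s * r) s (z + y * s)) = 1"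
proof -
  have iff: "arc (s * r) s w = of_bool ((w div s) mod r = 0)" for w
  proof -
    have w: "w mod (s * r) = s * ((w div s) mod r) + w mod s"
      using assms zmod_zmult2_eq[of r w s] by (simp add: algebra_simps)
    have "w mod s < s" "0 \<le> w mod s" "0 \<le> (w div s) mod r"
      using assms by auto
    then have "w mod (s * r) < s \<longleftrightarrow> (w div s) mod r = 0"
      unfolding w using assms(1)
      by (smt (verit) mult_le_cancel_left1 mult_cancel_left1 mult_eq_0_iff zmult_zless_mono2)
    then show ?thesis by (simp add: arc_def)
  qed
  have "(\<Sum>y\<in>{0..<r}. arc (s * r) s (z + y * s))
      = (\<Sum>y\<in>{0..<r}. of_bool ((y + z div s) mod r = 0))"
    using assms by (intro sum.cong) (simp_all add: iff add.commute)
  also have "\<dots> = (\<Sum>y\<in>{0..<r}. of_bool (y mod r = 0))"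
    using sum_periodic_shift[of r "\<lambda>y. of_bool (y mod r = 0)"] assms by simp
  also have "\<dots> = (\<Sum>y\<in>{0..<r}. if y = 0 then 1 else 0)"
    by (intro sum.cong) auto
  also have "\<dots> = 1" using assms by simp
  finally show ?thesis .
qed

text \<open>The modulus will be a power of two, so \<open>d\<close> need not be invertible. Modulo
  \<open>q\<close> its multiples form the subgroup generated by \<open>gcd d q\<close>, and an arc
  whose length is a multiple of that generator still gets its fair share.\<close>

lemma arc_progression_sum:
  fixes s q d x :: int
  assumes "s > 0" "q > 0" "s dvd q" "gcd d q dvd s"
  shows "(\<Sum>a\<in>{0..<q}. arc q s (x + a * d)) = s"
proof -
  obtain r where r: "q = s * r" using assms(3) by auto
  then have "r > 0" using assms by (simp add: zero_less_mult_iff)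
  obtain k where k: "s = gcd d q * k" using assms(4) by auto
  \<comment> \<open>Shifting \<open>a\<close> by \<open>a0\<close> moves the progression by \<open>s\<close>, so the sum is the same for all \<open>q / s\<close>
    translates of the arc, which tile a full period.\<close>
  obtain u v where uv: "u * d + v * q = gcd d q" using bezout_int by blast
  define a0 where "a0 = u * k"
  have "a0 * d = s - (v * k) * q"
    unfolding a0_def k uv[symmetric] by (simp add: algebra_simps)
  then have a0: "[a0 * d = s] (mod q)"
    by (simp add: cong_iff_dvd_diff)
  have inv: "(\<Sum>a\<in>{0..<q}. arc q s (x + a * d + y * s)) = (\<Sum>a\<in>{0..<q}. arc q s (x + a * d))" for y
  proof -
    have "[x + (a + y * a0) * d = x + a * d + y * s] (mod q)" for a
      using cong_add[OF cong_refl[of "x + a * d"] cong_scalar_left[OF a0, of y]]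
      by (simp add: algebra_simps)
    then have "arc q s (x + a * d + y * s) = arc q s (x + (a + y * a0) * d)" for a
      by (simp add: arc_def cong_def)
    moreover have "arc q s (x + (z mod q) * d) = arc q s (x + z * d)" for z
      by (simp add: arc_def) (metis mod_add_right_eq mod_mult_left_eq)
    ultimately show ?thesis
      using sum_periodic_shift[of q "\<lambda>a. arc q s (x + a * d)" "y * a0"] assms(2) by simp
  qed
  have "r * (\<Sum>a\<in>{0..<q}. arc q s (x + a * d))
      = (\<Sum>y\<in>{0..<r}. \<Sum>a\<in>{0..<q}. arc q s (x + a * d + y * s))"
    unfolding inv using \<open>r > 0\<close> by simp
  also have "\<dots> = (\<Sum>a\<in>{0..<q}. \<Sum>y\<in>{0..<r}. arc q s (x + a * d + y * s))"
    by (rule sum.swap)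
  also have "\<dots> = (\<Sum>a\<in>{0..<q}. 1)"
    using arc_tiling[OF assms(1) \<open>r > 0\<close>] r by simp
  also have "\<dots> = r * real_of_int s" using assms(2) r by simp
  finally show ?thesis using \<open>r > 0\<close> by simp
qed

lemma arc_sum:
  fixes s q c :: int
  assumes "0 \<le> s" "s \<le> q" "q > 0"
  shows "(\<Sum>b\<in>{0..<q}. arc q s (c + b)) = s"
proof -
  have "(\<Sum>b\<in>{0..<q}. arc q s (c + b)) = (\<Sum>b\<in>{0..<q}. arc q s b)"
    using sum_periodic_shift[of q "arc q s" c] assms by (simp add: add.commute)
  also have "\<dots> = (\<Sum>b\<in>{0..<s}. 1)"
    using assms by (intro sum.mono_neutral_cong_right) (auto simp: arc_def)
  finally show ?thesis using assms by simp
qed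

text \<open>Pairwise independence of the hash functions
  \<open>u \<mapsto> (a * u + b) mod q\<close>: shifting \<open>b\<close> by \<open>a * u\<close>
  turns the first hash value into \<open>b\<close> itself, and the second then runs through a
  progression with difference \<open>v - u\<close>.\<close>

lemma arc_pair_sum:
  fixes s q u v :: int
  assumes "s > 0" "q > 0" "s dvd q" "gcd (v - u) q dvd s"
  shows "(\<Sum>a\<in>{0..<q}. \<Sum>b\<in>{0..<q}. arc q s (a * u + b) * arc q s (a * v + b)) = s\<^sup>2"
proof -
  have "s \<le> q" using assms zdvd_imp_le by blast
  have "(\<Sum>b\<in>{0..<q}. arc q s (a * u + b) * arc q s (a * v + b))
      = (\<Sum>b\<in>{0..<s}. arc q s (b + a * (v - u)))" for a
  proof -
    have "(\<Sum>b\<in>{0..<q}. arc q s (a * u + b) * arc q s (a * v + b))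
        = (\<Sum>b\<in>{0..<q}. arc q s b * arc q s (b + a * (v - u)))"
    proof -
      have "arc q s (z mod q + a * (v - u)) = arc q s (z + a * (v - u))" for z
        by (simp add: arc_def mod_add_left_eq)
      then show ?thesis
        using sum_periodic_shift[of q "\<lambda>b. arc q s b * arc q s (b + a * (v - u))" "a * u"] assms
        by (simp add: algebra_simps)
    qed
    also have "\<dots> = (\<Sum>b\<in>{0..<s}. arc q s (b + a * (v - u)))"
      using \<open>s \<le> q\<close> by (intro sum.mono_neutral_cong_right) (auto simp: arc_def)
    finally show ?thesis .
  qed
  then have "(\<Sum>a\<in>{0..<q}. \<Sum>b\<in>{0..<q}. arc q s (a * u + b) * arc q s (a * v + b))
      = (\<Sum>a\<in>{0..<q}. \<Sum>b\<in>{0..<s}. arc q s (b + a * (v - u)))"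
    by simp
  also have "\<dots> = (\<Sum>b\<in>{0..<s}. \<Sum>a\<in>{0..<q}. arc q s (b + a * (v - u)))"
    by (rule sum.swap)
  also have "\<dots> = (\<Sum>b\<in>{0..<s}. s)"
    using arc_progression_sum[OF assms] by simp
  also have "\<dots> = s\<^sup>2" using assms by (simp add: power2_eq_square)
  finally show ?thesis .
qed

section \<open>Moments of the number of hits\<close>

text \<open>The pair \<open>(a, b)\<close> stands for a leaf of density \<open>s / q\<close> and
  \<open>S\<close> for the transmitting middle nodes; the value 1 is the case in which the leaf can
  receive.\<close>

definition hits :: "int \<Rightarrow> int \<Rightarrow> nat set \<Rightarrow> int \<times> int \<Rightarrow> nat" where
  "hits q s S = (\<lambda>(a, b). card {u \<in> S. (a * int u + b) mod q < s})"

lemma hits_eq_sum: "finite S \<Longrightarrow> real (hits q s S (a, b)) = (\<Sum>u\<in>S. arc q s (a * int u + b))"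
  by (simp add: hits_def arc_def Collect_conj_eq Int_commute)

lemma hits_first_moment:
  fixes s q :: int
  assumes "finite S" "s > 0" "q > 0" "s \<le> q"
  shows "(\<Sum>p\<in>{0..<q}\<times>{0..<q}. real (hits q s S p)) = card S * q * s"
proof -
  have "(\<Sum>p\<in>{0..<q}\<times>{0..<q}. real (hits q s S p))
     = (\<Sum>a\<in>{0..<q}. \<Sum>b\<in>{0..<q}. \<Sum>u\<in>S. arc q s (a * int u + b))"
    by (simp add: sum.cartesian_product' hits_eq_sum[OF assms(1)])
  also have "\<dots> = (\<Sum>a\<in>{0..<q}. \<Sum>u\<in>S. \<Sum>b\<in>{0..<q}. arc q s (a * int u + b))"
    by (intro sum.cong refl sum.swap)
  also have "\<dots> = card S * q * s"
    using assms by (simp add: arc_sum)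
  finally show ?thesis .
qed

text \<open>After expanding the square, each diagonal pair gives \<open>q * s\<close> as in the
  first moment, and each ordered pair of distinct elements gives \<open>s\<^sup>2\<close> by
  pairwise independence.\<close>

lemma hits_second_moment:
  fixes s q :: int
  assumes "finite S" "s > 0" "q > 0" "s dvd q"
    and gcd: "\<And>u v. u \<in> S \<Longrightarrow> v \<in> S \<Longrightarrow> u \<noteq> v \<Longrightarrow> gcd (int v - int u) q dvd s"
  shows "(\<Sum>p\<in>{0..<q}\<times>{0..<q}. (real (hits q s S p))\<^sup>2)
    = card S * q * s + card S * (real (card S) - 1) * s\<^sup>2"
proof -
  let ?P = "\<lambda>u v. \<Sum>a\<in>{0..<q}. \<Sum>b\<in>{0..<q}. arc q s (a * int u + b) * arc q s (a * int v + b)"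
  have "s \<le> q" using assms zdvd_imp_le by blast
  have diag: "?P u u = q * s" for u
  proof -
    have "?P u u = (\<Sum>a\<in>{0..<q}. \<Sum>b\<in>{0..<q}. arc q s (a * int u + b))"
      by (intro sum.cong refl) (simp add: arc_def)
    then show ?thesis using assms \<open>s \<le> q\<close> by (simp add: arc_sum)
  qed
  have "(\<Sum>p\<in>{0..<q}\<times>{0..<q}. (real (hits q s S p))\<^sup>2)
     = (\<Sum>p\<in>{0..<q}\<times>{0..<q}. \<Sum>u\<in>S. \<Sum>v\<in>S.
          arc q s (fst p * int u + snd p) * arc q s (fst p * int v + snd p))"
    by (intro sum.cong refl) (auto simp: hits_eq_sum[OF assms(1)] power2_eq_square sum_product)
  also have "\<dots> = (\<Sum>u\<in>S. \<Sum>p\<in>{0..<q}\<times>{0..<q}. \<Sum>v\<in>S.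
          arc q s (fst p * int u + snd p) * arc q s (fst p * int v + snd p))"
    by (rule sum.swap)
  also have "\<dots> = (\<Sum>u\<in>S. \<Sum>v\<in>S. \<Sum>p\<in>{0..<q}\<times>{0..<q}.
          arc q s (fst p * int u + snd p) * arc q s (fst p * int v + snd p))"
    by (intro sum.cong refl sum.swap)
  also have "\<dots> = (\<Sum>u\<in>S. \<Sum>v\<in>S. ?P u v)"
    by (simp add: sum.cartesian_product')
  also have "\<dots> = (\<Sum>u\<in>S. real_of_int (q * s) + (\<Sum>v\<in>S - {u}. real_of_int (s\<^sup>2)))"
  proof (intro sum.cong refl)
    fix u assume u: "u \<in> S"
    have "(\<Sum>v\<in>S. ?P u v) = ?P u u + (\<Sum>v\<in>S - {u}. ?P u v)"
      using u assms(1) by (rule sum.remove[rotated])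
    also have "(\<Sum>v\<in>S - {u}. ?P u v) = (\<Sum>v\<in>S - {u}. real_of_int (s\<^sup>2))"
    proof (rule sum.cong)
      fix v assume "v \<in> S - {u}"
      then have "gcd (int v - int u) q dvd s" using gcd u by auto
      from arc_pair_sum[OF assms(2-4) this] show "?P u v = real_of_int (s\<^sup>2)" by simp
    qed simp
    finally show "(\<Sum>v\<in>S. ?P u v) = real_of_int (q * s) + (\<Sum>v\<in>S - {u}. real_of_int (s\<^sup>2))"
      using diag by simp
  qed
  also have "\<dots> = card S * q * s + card S * (real (card S) - 1) * s\<^sup>2"
  proof -
    have "real (card (S - {u})) = real (card S) - 1" if "u \<in> S" for u
      using that assms(1) by (metis One_nat_def card_Suc_Diff1 add_diff_cancel_left' of_nat_1 of_nat_add plus_1_eq_Suc)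
    then have "(\<Sum>u\<in>S. real_of_int (q * s) + (\<Sum>v\<in>S - {u}. real_of_int (s\<^sup>2)))
        = (\<Sum>u\<in>S. real_of_int (q * s) + (real (card S) - 1) * real_of_int (s\<^sup>2))"
      by (intro sum.cong) auto
    then show ?thesis by (simp add: algebra_simps)
  qed
  finally show ?thesis .
qed

text \<open>The variance is at most the mean \<open>\<mu>\<close>, and every hash function with
  exactly \<open>c\<close> hits contributes \<open>(\<mu> - c)\<^sup>2\<close> to the total squared
  deviation.\<close>

lemma hits_chebyshev:
  fixes s q :: int and \<mu> :: real
  assumes "finite S" "s > 0" "q > 0" "s dvd q"
    and gcd: "\<And>u v. u \<in> S \<Longrightarrow> v \<in> S \<Longrightarrow> u \<noteq> v \<Longrightarrow> gcd (int v - int u) q dvd s"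
    and mu: "\<mu> = card S * s / q"
  shows "card {p \<in> {0..<q}\<times>{0..<q}. hits q s S p = c} * (\<mu> - real c)\<^sup>2 \<le> q\<^sup>2 * \<mu>"
proof -
  let ?Q = "{0..<q}\<times>{0..<q}" and ?X = "\<lambda>p. real (hits q s S p)"
  have "s \<le> q" using assms zdvd_imp_le by blast
  have "card {p \<in> ?Q. hits q s S p = c} * (\<mu> - real c)\<^sup>2
     = (\<Sum>p\<in>{p \<in> ?Q. hits q s S p = c}. (?X p - \<mu>)\<^sup>2)"
    by (simp add: power2_commute)
  also have "\<dots> \<le> (\<Sum>p\<in>?Q. (?X p - \<mu>)\<^sup>2)"
    by (intro sum_mono2) auto
  also have "\<dots> = (\<Sum>p\<in>?Q. (?X p)\<^sup>2) - 2 * \<mu> * (\<Sum>p\<in>?Q. ?X p) + \<mu>\<^sup>2 * q\<^sup>2"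
    using assms(3) by (simp add: power2_diff sum.distrib sum_subtractf sum_distrib_left algebra_simps power2_eq_square)
  also have "\<dots> = card S * s * (real_of_int q - s)"
    unfolding hits_first_moment[OF assms(1-3) \<open>s \<le> q\<close>] hits_second_moment[OF assms(1-4) gcd, simplified]
      mu using assms(3) by (simp add: field_simps power2_eq_square)
  also have "\<dots> \<le> card S * s * real_of_int q"
    using assms by (intro mult_left_mono) auto
  also have "\<dots> = q\<^sup>2 * \<mu>"
    unfolding mu using assms(3) by (simp add: power2_eq_square)
  finally show ?thesis .
qed

text \<open>Markov's inequality gives the bound by \<open>\<mu>\<close>. The bound by
  \<open>4 / \<mu>\<close> follows from it for \<open>\<mu> \<le> 2\<close>, and from the variance
  otherwise, where \<open>\<mu> - 1 \<ge> \<mu> / 2\<close>.\<close>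

lemma hits_unique_bound:
  fixes s q :: int and \<mu> :: real
  assumes "finite S" "s > 0" "q > 0" "s dvd q"
    and gcd: "\<And>u v. u \<in> S \<Longrightarrow> v \<in> S \<Longrightarrow> u \<noteq> v \<Longrightarrow> gcd (int v - int u) q dvd s"
    and mu: "\<mu> = card S * s / q"
  shows "card {p \<in> {0..<q}\<times>{0..<q}. hits q s S p = 1} \<le> q\<^sup>2 * min \<mu> (4 / \<mu>)"
proof -
  let ?Q = "{0..<q}\<times>{0..<q}" and ?N = "card {p \<in> {0..<q}\<times>{0..<q}. hits q s S p = 1}"
  have "s \<le> q" using assms zdvd_imp_le by blast
  have "real ?N = (\<Sum>p\<in>{p \<in> ?Q. hits q s S p = 1}. real (hits q s S p))"
    by simp
  also have "\<dots> \<le> (\<Sum>p\<in>?Q. real (hits q s S p))"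
    by (intro sum_mono2) auto
  also have "\<dots> = q\<^sup>2 * \<mu>"
    unfolding hits_first_moment[OF assms(1-3) \<open>s \<le> q\<close>] mu using assms(3) by (simp add: power2_eq_square)
  finally have 1: "?N \<le> q\<^sup>2 * \<mu>" .
  have "?N \<le> q\<^sup>2 * (4 / \<mu>)"
  proof (cases "\<mu> \<le> 2")
    case True
    have "\<mu> \<ge> 0" using mu assms by simp
    \<comment> \<open>At \<open>\<mu> = 0\<close> the quotient \<open>4 / \<mu>\<close> is 0 by
      convention, but the first bound is 0 as well.\<close>
    show ?thesis
    proof (cases "\<mu> = 0")
      case False
      then have "\<mu> * \<mu> \<le> 2 * 2" using True \<open>\<mu> \<ge> 0\<close> by (intro mult_mono) auto
      then have "\<mu> \<le> 4 / \<mu>" using False \<open>\<mu> \<ge> 0\<close> by (simp add: field_simps)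
      with 1 show ?thesis by (smt (verit) mult_left_mono of_int_0_le_iff zero_le_power2)
    qed (use 1 in simp)
  next
    case False
    have "?N * (\<mu> / 2)\<^sup>2 \<le> ?N * (\<mu> - 1)\<^sup>2"
      using False by (intro mult_left_mono power_mono) auto
    also have "\<dots> \<le> q\<^sup>2 * \<mu>"
      using hits_chebyshev[OF assms, of 1] by simp
    finally show ?thesis using False by (simp add: field_simps power2_eq_square)
  qed
  with 1 show ?thesis by (simp add: min_def)
qed

section \<open>Combining all scales\<close>

text \<open>The terms double while \<open>t / 2 ^ i\<close> is above 2 and halve once it is below,
  so two geometric series bound the sum independently of the number of scales.\<close>

lemma sum_geometric_min_le:
  fixes t :: real
  assumes "t \<ge> 0"
  shows "(\<Sum>i<d. min (t / 2 ^ i) (4 / (t / 2 ^ i))) \<le> 8"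
proof -
  have low: "(\<Sum>i<d. min (t / 2 ^ i) (4 / (t / 2 ^ i))) \<le> 2 * t" if "t \<ge> 0" for t :: real and d
  proof -
    have "(\<Sum>i<d. min (t / 2 ^ i) (4 / (t / 2 ^ i))) \<le> (\<Sum>i<d. t * (1/2) ^ i)"
      by (intro sum_mono) (simp add: power_one_over field_simps)
    also have "\<dots> = t * (2 - 2 * (1/2) ^ d)"
      by (simp add: sum_distrib_left[symmetric] sum_gp_strict)
    also have "\<dots> \<le> t * 2" using that by (intro mult_left_mono) auto
    finally show ?thesis by simp
  qed
  \<comment> \<open>The correction \<open>- 4 / t\<close> carries the induction: halving
    \<open>t\<close> doubles it, which pays for the leading term \<open>4 / t\<close>.\<close>
  have high: "(\<Sum>i<d. min (t / 2 ^ i) (4 / (t / 2 ^ i))) \<le> 8 - 4 / t" if "t \<ge> 1" for t :: real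
    using that
  proof (induction d arbitrary: t)
    case (Suc d)
    show ?case
    proof (cases "t \<le> 2")
      case True
      \<comment> \<open>The product gives \<open>t\<^sup>2 + 2 \<le> 3 * t \<le> 4 * t\<close>,
        which is the next inequality with denominators cleared.\<close>
      then have "0 \<le> (t - 1) * (2 - t)" using Suc.prems by (intro mult_nonneg_nonneg) auto
      then have "2 * t \<le> 8 - 4 / t" using Suc.prems True by (simp add: field_simps)
      with low[of t "Suc d"] Suc.prems show ?thesis by linarith
    next
      case False
      have "(\<Sum>i<Suc d. min (t / 2 ^ i) (4 / (t / 2 ^ i)))
          = min t (4 / t) + (\<Sum>i<d. min (t / 2 / 2 ^ i) (4 / (t / 2 / 2 ^ i)))"
        by (subst sum.lessThan_Suc_shift) simp
      also have "\<dots> \<le> 4 / t + (8 - 4 / (t / 2))"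
        using Suc.IH[of "t / 2"] False by (intro add_mono) auto
      also have "\<dots> = 8 - 4 / t" by simp
      finally show ?thesis .
    qed
  qed (simp add: field_simps)
  show ?thesis
  proof (cases "t \<ge> 1")
    case True then show ?thesis using high[OF True] by (smt (verit) divide_nonneg_nonneg)
  next
    case False then show ?thesis using low[OF assms, of d] by linarith
  qed
qed

text \<open>As a divisor of \<open>4 ^ d\<close> the gcd is a power of two, and it is below
  \<open>2 ^ d\<close> because the labels differ by less than that. This supplies the gcd hypothesis
  for every arc of length at least \<open>2 ^ d\<close>.\<close>

lemma gcd_diff_dvd_power_of_two:
  assumes "u < 2 ^ d" "v < 2 ^ d" "u \<noteq> v" "d \<le> e"
  shows "gcd (int v - int u) (4 ^ d) dvd 2 ^ e"
proof -
  let ?g = "gcd (int v - int u) (4 ^ d)"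
  have "?g dvd 2 ^ (2 * d)" by (simp add: power_mult)
  then obtain j where j: "normalize ?g = 2 ^ j"
    using divides_primepow[of "2::int" ?g "2 * d"] by auto
  have "int u < 2 ^ d" "int v < 2 ^ d"
    using assms(1,2) by (metis of_nat_less_iff of_nat_numeral of_nat_power)+
  then have "\<bar>int v - int u\<bar> < 2 ^ d" by linarith
  moreover have "?g \<le> \<bar>int v - int u\<bar>"
    using assms(3) zdvd_imp_le[of ?g "\<bar>int v - int u\<bar>"] by auto
  ultimately have "(2::int) ^ j < 2 ^ d" using j unfolding normalize_gcd by linarith
  then have "j < d" by simp
  then show ?thesis
    using j assms(4) le_imp_power_dvd[of j e "2::int"] by simp
qed

text \<open>A leaf is a scale with one of the \<open>16 ^ d\<close> hash functions. The number of
  leaves grows with the number \<open>d\<close> of scales, whereas the uniquely hit ones sum to at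
  most \<open>8 * 16 ^ d\<close>, a fraction of at most \<open>16 / d\<close>.\<close>

lemma sparse_unique_hitting_family:
  assumes "d \<ge> 1"
  obtains L :: "(nat \<times> int \<times> int) set" and nb :: "nat \<times> int \<times> int \<Rightarrow> nat set"
  where "finite L" "card L \<le> d * 16 ^ d" "d * 16 ^ d \<le> 2 * card L"
    "\<And>l. l \<in> L \<Longrightarrow> nb l \<noteq> {} \<and> nb l \<subseteq> {..<2 ^ d}"
    "\<And>S. S \<subseteq> {..<2 ^ d} \<Longrightarrow> card {l \<in> L. card (nb l \<inter> S) = 1} \<le> 8 * 16 ^ d"
proof -
  \<comment> \<open>The modulus \<open>4 ^ d\<close> is large enough that arcs of density
    \<open>1 / 2 ^ i\<close> with \<open>i < d\<close> still have length at least
    \<open>2 ^ d\<close>.\<close>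
  define q :: int where "q = 4 ^ d"
  define s :: "nat \<Rightarrow> int" where "s i = 2 ^ (2 * d - i)" for i
  define Q where "Q = {0..<q} \<times> {0..<q}"
  define nb where "nb = (\<lambda>(i, a, b). {u \<in> {..<2 ^ d}. (a * int u + b) mod q < s i})"
  define L0 where "L0 = {..<d} \<times> Q"
  \<comment> \<open>A leaf without neighbours would disconnect the network; at most half of them are lost.\<close>
  define L where "L = {l \<in> L0. nb l \<noteq> {}}"
  have q2: "real_of_int (q\<^sup>2) = 16 ^ d"
    unfolding q_def by (simp add: power2_eq_square power_mult_distrib[symmetric])
  have cQ: "card Q = 16 ^ d"
    unfolding Q_def q_def by (simp add: nat_power_eq power_mult_distrib[symmetric])
  have [simp]: "finite Q" "finite L0" by (auto simp: Q_def L0_def)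
  have cL0: "card L0 = d * 16 ^ d" by (simp add: L0_def cQ)
  have pos: "s i > 0" "q > 0" for i by (auto simp: s_def q_def)
  have sq: "s i dvd q" for i
  proof -
    have "q = 2 ^ (2 * d)" by (simp add: q_def power_mult)
    then show ?thesis by (simp add: s_def le_imp_power_dvd)
  qed
  have ratio: "real_of_int (s i) / q = 1 / 2 ^ i" if "i < d" for i
  proof -
    have "(2::real) ^ (2 * d - i) * 2 ^ i = 4 ^ d"
      using that by (simp add: power_add[symmetric] power_mult)
    then show ?thesis by (simp add: s_def q_def field_simps)
  qed
  have gcd: "gcd (int v - int u) q dvd s i"
    if "i < d" "S \<subseteq> {..<2 ^ d}" "u \<in> S" "v \<in> S" "u \<noteq> v" for i u v S
    unfolding q_def s_def using that by (intro gcd_diff_dvd_power_of_two) auto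
  have hits: "card (nb (i, p) \<inter> S) = hits q (s i) S p" if "S \<subseteq> {..<2 ^ d}" for i p S
    unfolding hits_def nb_def using that by (auto split: prod.splits intro!: arg_cong[where f = card])
  show ?thesis
  proof
    show "finite L" by (simp add: L_def)
    show "card L \<le> d * 16 ^ d"
      unfolding cL0[symmetric] by (intro card_mono) (auto simp: L_def)
    show "nb l \<noteq> {} \<and> nb l \<subseteq> {..<2 ^ d}" if "l \<in> L" for l
      using that by (auto simp: L_def nb_def)
    show "card {l \<in> L. card (nb l \<inter> S) = 1} \<le> 8 * 16 ^ d" if S: "S \<subseteq> {..<2 ^ d}" for S
    proof -
      have fS: "finite S" using S finite_subset by blast
      have "card {l \<in> L. card (nb l \<inter> S) = 1} \<le> card (SIGMA i:{..<d}. {p \<in> Q. hits q (s i) S p = 1})"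
        by (intro card_mono) (auto simp: L_def L0_def hits[OF S])
      also have "\<dots> = (\<Sum>i<d. card {p \<in> Q. hits q (s i) S p = 1})"
        by (subst card_SigmaI) auto
      finally have "real (card {l \<in> L. card (nb l \<inter> S) = 1})
          \<le> real (\<Sum>i<d. card {p \<in> Q. hits q (s i) S p = 1})"
        by (rule of_nat_mono)
      also have "\<dots> = (\<Sum>i<d. real (card {p \<in> Q. hits q (s i) S p = 1}))" by simp
      also have "\<dots> \<le> (\<Sum>i<d. q\<^sup>2 * min (card S / 2 ^ i) (4 / (card S / 2 ^ i)))"
      proof (intro sum_mono)
        fix i assume "i \<in> {..<d}"
        then have i: "i < d" by simp
        show "real (card {p \<in> Q. hits q (s i) S p = 1})
          \<le> q\<^sup>2 * min (card S / 2 ^ i) (4 / (card S / 2 ^ i))"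
          unfolding Q_def using ratio[OF i]
          by (intro hits_unique_bound[OF fS pos sq gcd[OF i S]]) (auto simp: field_simps)
      qed
      also have "\<dots> = 16 ^ d * (\<Sum>i<d. min (card S / 2 ^ i) (4 / (card S / 2 ^ i)))"
        by (simp only: sum_distrib_left q2)
      also have "\<dots> \<le> 16 ^ d * 8"
        by (intro mult_left_mono sum_geometric_min_le) auto
      also have "\<dots> = real (8 * 16 ^ d)" by simp
      finally show ?thesis by (simp only: of_nat_le_iff)
    qed
    show "d * 16 ^ d \<le> 2 * card L"
    proof -
      let ?M = "{..<2 ^ d} :: nat set"
      \<comment> \<open>A leaf is isolated iff the full middle layer hits it zero times. There
        \<open>\<mu> \<ge> 2\<close>, so the variance bound with \<open>c = 0\<close> leaves a
        fraction of at most \<open>1 / \<mu> \<le> 1 / 2\<close>.\<close>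
      have empty: "2 * card {p \<in> Q. hits q (s i) ?M p = 0} \<le> 16 ^ d" if i: "i < d" for i
      proof -
        let ?N = "real (card {p \<in> Q. hits q (s i) ?M p = 0})"
        define \<mu> :: real where "\<mu> = 2 ^ d / 2 ^ i"
        have "(2::real) * 2 ^ i \<le> 2 ^ d"
          using i power_increasing[of "Suc i" d "2::real"] by simp
        then have "\<mu> \<ge> 2" by (simp add: \<mu>_def field_simps)
        have "?N * (\<mu> - real 0)\<^sup>2 \<le> q\<^sup>2 * \<mu>"
          unfolding Q_def using ratio[OF i]
          by (intro hits_chebyshev[OF _ pos sq gcd[OF i order_refl]]) (auto simp: \<mu>_def field_simps)
        then have "?N * \<mu> \<le> 16 ^ d"
          unfolding q2 using \<open>\<mu> \<ge> 2\<close> by (simp add: power2_eq_square)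
        moreover have "?N * 2 \<le> ?N * \<mu>" using \<open>\<mu> \<ge> 2\<close> by (intro mult_left_mono) auto
        ultimately have "real (2 * card {p \<in> Q. hits q (s i) ?M p = 0}) \<le> real (16 ^ d)" by simp
        then show ?thesis by (simp only: of_nat_le_iff)
      qed
      have "L0 - L \<subseteq> (SIGMA i:{..<d}. {p \<in> Q. hits q (s i) ?M p = 0})"
        by (auto simp: L_def L0_def hits[OF order_refl, symmetric])
      then have "card (L0 - L) \<le> card (SIGMA i:{..<d}. {p \<in> Q. hits q (s i) ?M p = 0})"
        by (intro card_mono) auto
      also have "\<dots> = (\<Sum>i<d. card {p \<in> Q. hits q (s i) ?M p = 0})"
        by (subst card_SigmaI) auto
      finally have "2 * card (L0 - L) \<le> (\<Sum>i<d. 2 * card {p \<in> Q. hits q (s i) ?M p = 0})"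
        by (simp add: sum_distrib_left[symmetric])
      also have "\<dots> \<le> (\<Sum>i<d. 16 ^ d)" using empty by (intro sum_mono) auto
      finally have "2 * card (L0 - L) \<le> d * 16 ^ d" by simp
      moreover have "card (L0 - L) = d * 16 ^ d - card L"
        unfolding cL0[symmetric] by (intro card_Diff_subset) (auto simp: L_def)
      ultimately show ?thesis by linarith
    qed
  qed
qed

section \<open>Networks of radius two\<close>

lemma graph_dist_le: "(u, v) \<in> E ^^ d \<Longrightarrow> graph_dist E u v \<le> enat d"
  unfolding graph_dist_def by (intro INF_lower) simp

lemma graph_dist_ge_two:
  assumes "u \<noteq> v" "(u, v) \<notin> E"
  shows "graph_dist E u v \<ge> 2"
  unfolding graph_dist_def
proof (rule INF_greatest)
  fix d assume "d \<in> {d. (u, v) \<in> E ^^ d}"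
  then have "d \<noteq> 0" "d \<noteq> 1" using assms by (auto intro: ccontr)
  then have "2 \<le> d" by linarith
  then show "2 \<le> enat d" by (simp add: numeral_eq_enat)
qed

lemma graph_radius_eq_two:
  assumes "c \<in> V" "\<And>v. v \<in> V \<Longrightarrow> graph_dist E c v \<le> 2"
    and "\<And>u. u \<in> V \<Longrightarrow> \<exists>v\<in>V. u \<noteq> v \<and> (u, v) \<notin> E"
  shows "graph_radius V E = 2"
proof (rule antisym)
  have "graph_radius V E \<le> eccentricity V E c"
    unfolding graph_radius_def using assms(1) by (rule INF_lower)
  also have "\<dots> \<le> 2"
    unfolding eccentricity_def using assms(2) by (rule SUP_least)
  finally show "graph_radius V E \<le> 2" .
  show "2 \<le> graph_radius V E"
    unfolding graph_radius_def eccentricity_def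
  proof (rule INF_greatest)
    fix u assume "u \<in> V"
    then obtain v where "v \<in> V" "u \<noteq> v" "(u, v) \<notin> E" using assms(3) by blast
    then show "2 \<le> (SUP v\<in>V. graph_dist E u v)"
      using graph_dist_ge_two by (metis SUP_upper2)
  qed
qed

text \<open>All neighbours of a leaf lie in the middle layer, so the bound for subsets of that layer
  extends to arbitrary sets of transmitters. Nonempty neighbourhoods put every leaf within two hops
  of the source.\<close>

lemma radius_two_network_of_neighbourhoods:
  fixes nb :: "'l \<Rightarrow> nat set"
  assumes L: "finite L" "L \<noteq> {}" and nb: "\<And>l. l \<in> L \<Longrightarrow> nb l \<noteq> {} \<and> nb l \<subseteq> {..<m}"
    and m: "m \<ge> 2" "m + card L < n"
    and hear: "\<And>S. S \<subseteq> {..<m} \<Longrightarrow> card {l \<in> L. card (nb l \<inter> S) = 1} \<le> K"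
  obtains V :: "nat set" and E R src where
    "radio_network V E" "card V = n" "graph_radius V E = 2"
    "R \<subseteq> V" "finite R" "card R = card L" "src \<in> V" "src \<notin> R"
    "\<And>X. card {v \<in> R. \<exists>!u. (u, v) \<in> E \<and> u \<in> X} \<le> K"
proof -
  \<comment> \<open>Vertex 0 is the source, \<open>Suc u\<close> for \<open>u < m\<close> the middle layer, \<open>R\<close> the listening leaves;
    the remaining vertices are padding attached to the source.\<close>
  define R where "R = {Suc m..<Suc m + card L}"
  define P where "P = {Suc m + card L..<n}"
  have cR: "card R = card L" and fR: "finite R" by (auto simp: R_def)
  then obtain e where e: "bij_betw e R L"
    using L finite_same_card_bij by metis
  then have eL: "v \<in> R \<Longrightarrow> e v \<in> L" for v by (auto simp: bij_betw_def)
  define F where "F = {0} \<times> ({1..m} \<union> P) \<union> {(Suc u, v) | u v. v \<in> R \<and> u \<in> nb (e v)}"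
  define E where "E = F \<union> F\<inverse>"
  have nbm: "v \<in> R \<Longrightarrow> u \<in> nb (e v) \<Longrightarrow> u < m" for u v using nb[OF eL] by auto
  have inR: "(w, v) \<in> E \<longleftrightarrow> (\<exists>u\<in>nb (e v). w = Suc u)" if "v \<in> R" for w v
    using that nbm by (fastforce simp: E_def F_def R_def P_def)
  have V: "{..<n} = insert 0 ({1..m} \<union> R \<union> P)"
    using m by (auto simp: R_def P_def)
  show ?thesis
  proof
    have "F \<subseteq> {..<n} \<times> {..<n}"
      using m nbm by (fastforce simp: F_def R_def P_def)
    moreover have "irrefl F"
      using nbm by (fastforce simp: F_def R_def P_def irrefl_def)
    ultimately show "radio_network {..<n} E"
      unfolding radio_network_def E_def by (auto simp: sym_def irrefl_def)
    show "graph_radius {..<n} E = 2"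
    proof (rule graph_radius_eq_two)
      show "0 \<in> {..<n}" using m by simp
      fix v assume v: "v \<in> {..<n}"
      then consider "v = 0" | "v \<in> {1..m} \<union> P" | "v \<in> R" using V by auto
      then show "graph_dist E 0 v \<le> 2"
      proof cases
        case 1
        then show ?thesis using graph_dist_le[of 0 v 0 E] by (simp add: zero_enat_def[symmetric] order_trans)
      next
        case 2
        then have "(0, v) \<in> E ^^ 1" by (simp add: E_def F_def)
        from graph_dist_le[OF this] show ?thesis
          by (rule order_trans) (simp add: numeral_eq_enat)
      next
        case 3
        then obtain u where u: "u \<in> nb (e v)" using nb[OF eL] by blast
        then have "(Suc u, v) \<in> E" using inR[OF 3] by blast
        moreover have "(0, Suc u) \<in> E" using nbm[OF 3 u] by (simp add: E_def F_def)
        ultimately have "(0, v) \<in> E ^^ 2" by (auto simp: numeral_2_eq_2)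
        from graph_dist_le[OF this] show ?thesis by (simp add: numeral_eq_enat)
      qed
    next
      fix u assume u: "u \<in> {..<n}"
      have "\<exists>r. r \<in> R" using L cR fR by (metis card_gt_0_iff ex_in_conv)
      then obtain r where r: "r \<in> R" ..
      consider "u = 0" | "u \<in> {1..m}" | "u \<in> R" | "u \<in> P" using u V by auto
      then show "\<exists>v\<in>{..<n}. u \<noteq> v \<and> (u, v) \<notin> E"
      proof cases
        case 1
        then have "(u, r) \<notin> E" using inR[OF r] by auto
        then show ?thesis using r 1 m by (intro bexI[of _ r]) (auto simp: R_def)
      next
        case 2
        \<comment> \<open>Middle vertices are pairwise nonadjacent, and \<open>m \<ge> 2\<close>
          provides a second one.\<close>
        define v where "v = (if u = 1 then 2 else 1 :: nat)"
        have "v \<in> {1..m}" "u \<noteq> v" using m by (auto simp: v_def)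
        moreover from this have "(u, v) \<notin> E"
          using 2 by (auto simp: E_def F_def R_def P_def)
        ultimately show ?thesis using m by (intro bexI[of _ v]) auto
      next
        case 3
        have "(u, 0) \<notin> E" using 3 by (auto simp: E_def F_def R_def P_def)
        then show ?thesis using 3 m by (intro bexI[of _ 0]) (auto simp: R_def)
      next
        case 4
        have "(u, 1) \<notin> E" using 4 m by (auto simp: E_def F_def R_def P_def)
        then show ?thesis using 4 m by (intro bexI[of _ 1]) (auto simp: P_def)
      qed
    qed
    show "card {v \<in> R. \<exists>!u. (u, v) \<in> E \<and> u \<in> X} \<le> K" for X
    proof -
      \<comment> \<open>The trace of \<open>X\<close> on the middle layer, with the vertex labels
        shifted back by one.\<close>
      define S where "S = {u. u < m \<and> Suc u \<in> X}"
      have "card {v \<in> R. \<exists>!u. (u, v) \<in> E \<and> u \<in> X} \<le> card {l \<in> L. card (nb l \<inter> S) = 1}"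
      proof (rule card_inj_on_le[of e])
        show "inj_on e {v \<in> R. \<exists>!u. (u, v) \<in> E \<and> u \<in> X}"
          using e by (auto simp: bij_betw_def inj_on_def)
        show "e ` {v \<in> R. \<exists>!u. (u, v) \<in> E \<and> u \<in> X} \<subseteq> {l \<in> L. card (nb l \<inter> S) = 1}"
        proof (rule image_subsetI)
          fix v assume "v \<in> {v \<in> R. \<exists>!u. (u, v) \<in> E \<and> u \<in> X}"
          then obtain w where v: "v \<in> R" and w: "(w, v) \<in> E" "w \<in> X"
            and uniq: "\<forall>y. (y, v) \<in> E \<and> y \<in> X \<longrightarrow> y = w" by blast
          obtain u where u: "u \<in> nb (e v)" "w = Suc u" using w inR[OF v] by blast
          have "nb (e v) \<inter> S = {u}"
          proof (intro equalityI subsetI)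
            fix u' assume "u' \<in> nb (e v) \<inter> S"
            then have "(Suc u', v) \<in> E" "Suc u' \<in> X" using inR[OF v] by (auto simp: S_def)
            then have "Suc u' = w" using uniq by blast
            then show "u' \<in> {u}" using u by simp
          qed (use u w nbm[OF v] in \<open>auto simp: S_def\<close>)
          then show "e v \<in> {l \<in> L. card (nb l \<inter> S) = 1}" using eL[OF v] by simp
        qed
      qed (use L in auto)
      also have "\<dots> \<le> K" by (rule hear) (auto simp: S_def)
      finally show ?thesis .
    qed
    show "R \<subseteq> {..<n}" "0 \<in> {..<n}" "0 \<notin> R" using m by (auto simp: R_def)
  qed (use cR fR in auto)
qed

section \<open>Counting reception histories\<close>

lemma sum_prod_list_lists:
  fixes f :: "'a \<Rightarrow> real"
  assumes "finite A"
  shows "(\<Sum>h\<in>{h. set h \<subseteq> A \<and> length h = T}. prod_list (map f h)) = (\<Sum>a\<in>A. f a) ^ T"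
proof (induction T)
  case 0
  have "{h. set h \<subseteq> A \<and> length h = 0} = {[]}" by auto
  then show ?case by simp
next
  case (Suc T)
  let ?H = "{h. set h \<subseteq> A \<and> length h = T}"
  have inj: "inj_on (\<lambda>(a, h). a # h) (A \<times> ?H)" by (auto simp: inj_on_def)
  have im: "{h. set h \<subseteq> A \<and> length h = Suc T} = (\<lambda>(a, h). a # h) ` (A \<times> ?H)"
    by (auto simp: length_Suc_conv)
  have "(\<Sum>h\<in>{h. set h \<subseteq> A \<and> length h = Suc T}. prod_list (map f h))
      = (\<Sum>(a, h)\<in>A \<times> ?H. f a * prod_list (map f h))"
    unfolding im sum.reindex[OF inj] by (intro sum.cong) auto
  also have "\<dots> = (\<Sum>a\<in>A. f a) * (\<Sum>h\<in>?H. prod_list (map f h))"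
    by (simp add: sum_product sum.cartesian_product)
  finally show ?case using Suc.IH by simp
qed

definition receptions :: "'a option list \<Rightarrow> nat" where
  "receptions h = length (filter (\<lambda>r. r \<noteq> None) h)"

definition received_values :: "nat \<Rightarrow> bits option set" where
  "received_values B = insert None (Some ` {p. length p = B})"

lemma finite_bits_length: "finite {p :: bits. length p = B}"
  using finite_lists_length_eq[of "UNIV :: bool set" B] by simp

lemma card_bits_length: "card {p :: bits. length p = B} = 2 ^ B"
  using card_lists_length_eq[of "UNIV :: bool set" B] by simp

lemma finite_received_values: "finite (received_values B)"
  by (simp add: received_values_def finite_bits_length)

text \<open>The weight factorises over the rounds; each round contributes 1 for silence and
  \<open>x\<close> for each of the \<open>2 ^ B\<close> packets.\<close>

lemma sum_power_receptions:
  "(\<Sum>h\<in>{h. set h \<subseteq> received_values B \<and> length h = T}. x ^ receptions h) = (1 + 2 ^ B * x :: real) ^ T"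
proof -
  let ?f = "\<lambda>r :: bits option. if r = None then 1 else x"
  have "x ^ receptions h = prod_list (map ?f h)" for h
    by (induction h) (auto simp: receptions_def)
  then have "(\<Sum>h\<in>{h. set h \<subseteq> received_values B \<and> length h = T}. x ^ receptions h)
      = (\<Sum>r\<in>received_values B. ?f r) ^ T"
    using sum_prod_list_lists[OF finite_received_values, of ?f B T] by simp
  also have "(\<Sum>r\<in>received_values B. ?f r) = 1 + (\<Sum>r\<in>Some ` {p :: bits. length p = B}. x)"
    unfolding received_values_def
    by (subst sum.insert)
      (auto simp: finite_bits_length sum.reindex simp del: sum_constant)
  also have "\<dots> = 1 + 2 ^ B * x"
    by (simp add: card_image card_bits_length)
  finally show ?thesis .
qed

lemma receives_in_received_values:
  assumes "\<And>u p. a u = Some p \<Longrightarrow> length p = B"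
  shows "receives E a v \<in> received_values B"
proof (cases "receives E a v")
  case (Some p)
  then have "a (THE u. (u, v) \<in> E \<and> a u \<noteq> None) = Some p"
    by (auto simp: receives_def split: if_splits)
  with Some show ?thesis using assms by (auto simp: received_values_def)
qed (simp add: received_values_def)

lemma history_in_received_values:
  assumes "packet_size B A"
  shows "set (history E A pl ms T v) \<subseteq> received_values B \<and> length (history E A pl ms T v) = T"
  using assms by (induction T) (auto intro!: receives_in_received_values simp: packet_size_def)

text \<open>The bound on receiving leaves holds for every transmitter set, so it applies in each
  round however the algorithm adapts to messages and history.\<close>

lemma sum_receptions_le:
  assumes "finite R"
    and hear: "\<And>X. real (card {v \<in> R. \<exists>!u. (u, v) \<in> E \<and> u \<in> X}) \<le> K"
  shows "(\<Sum>v\<in>R. real (receptions (history E A pl ms T v))) \<le> T * K"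
proof (induction T)
  case (Suc T)
  define a where "a u = action A (u, initial_messages pl ms u, history E A pl ms T u)" for u
  have "(\<Sum>v\<in>R. real (receptions (history E A pl ms (Suc T) v)))
     = (\<Sum>v\<in>R. real (receptions (history E A pl ms T v)))
       + (\<Sum>v\<in>R. of_bool (receives E a v \<noteq> None))"
    by (simp add: receptions_def a_def[abs_def] sum.distrib[symmetric] del: sum_of_bool_eq)
       (intro sum.cong, auto)
  also have "(\<Sum>v\<in>R. of_bool (receives E a v \<noteq> None)) = real (card {v \<in> R. receives E a v \<noteq> None})"
    using assms(1) by (simp add: Collect_conj_eq)
  also have "\<dots> \<le> real (card {v \<in> R. \<exists>!u. (u, v) \<in> E \<and> u \<in> {u. a u \<noteq> None}})"
    using assms(1) by (intro of_nat_mono card_mono) (auto simp: receives_def split: if_splits)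
  also have "\<dots> \<le> K" by (rule hear)
  finally show ?case using Suc.IH by (simp add: algebra_simps)
qed (simp add: receptions_def)

lemma finite_message_lists: "finite (message_lists k b)"
  and card_message_lists: "card (message_lists k b) = 2 ^ (b * k)"
proof -
  have eq: "message_lists k b = {ms. set ms \<subseteq> {p. length p = b} \<and> length ms = k}"
    by (auto simp: message_lists_def)
  show "finite (message_lists k b)"
    unfolding eq by (rule finite_lists_length_eq[OF finite_bits_length])
  show "card (message_lists k b) = 2 ^ (b * k)"
    unfolding eq card_lists_length_eq[OF finite_bits_length] card_bits_length by (simp add: power_mult)
qed

text \<open>Double counting of the weights \<open>x ^ receptions\<close> over delivered lists and
  leaves, with \<open>x = 1 / y\<close>: \<open>leaf\<close> bounds the sum at a fixed leaf from
  above, \<open>message\<close> the sum for a fixed list from below.\<close>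

lemma card_delivered_le:
  fixes y \<epsilon> :: real
  assumes A: "packet_size B A" and R: "finite R" "R \<noteq> {}" "R \<subseteq> V" "src \<notin> R"
    and hear: "\<And>X. real (card {v \<in> R. \<exists>!u. (u, v) \<in> E \<and> u \<in> X}) \<le> \<epsilon> * card R"
    and y: "y \<ge> 1"
  shows "card {ms \<in> message_lists k b. delivers V E T A (\<lambda>_. src) ms}
    \<le> y powr (\<epsilon> * T) * (1 + 2 ^ B / y) ^ T"
proof -
  define G where "G = {ms \<in> message_lists k b. delivers V E T A (\<lambda>_. src) ms}"
  define hist where "hist ms v = history E A (\<lambda>_. src) ms T v" for ms v
  define H where "H = {h. set h \<subseteq> received_values B \<and> length h = T}"
  define x where "x = 1 / y"
  have x: "0 < x" "ln x \<le> 0" using y by (auto simp: x_def ln_div)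
  have [simp]: "finite G" unfolding G_def using finite_message_lists by simp
  have "finite H" unfolding H_def by (rule finite_lists_length_eq[OF finite_received_values])
  have leaf: "(\<Sum>ms\<in>G. x ^ receptions (hist ms v)) \<le> (1 + 2 ^ B * x) ^ T" if v: "v \<in> R" for v
  proof -
    \<comment> \<open>All messages start at the source, so a leaf has no initial data and must
      decode from its history alone.\<close>
    have "inj_on (\<lambda>ms. hist ms v) G"
    proof (rule inj_onI)
      fix ms ms' assume ms: "ms \<in> G" "ms' \<in> G" "hist ms v = hist ms' v"
      have "initial_messages (\<lambda>_. src) m v = (\<lambda>_. None)" for m
        using v R(4) by (auto simp: initial_messages_def)
      moreover have "m \<in> G \<Longrightarrow> decode A (v, initial_messages (\<lambda>_. src) m v, hist m v) = m" for m
        using v R(3) unfolding G_def delivers_def hist_def by blast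
      ultimately have "m \<in> G \<Longrightarrow> decode A (v, \<lambda>_. None, hist m v) = m" for m
        by metis
      then show "ms = ms'" using ms by metis
    qed
    then have "(\<Sum>ms\<in>G. x ^ receptions (hist ms v)) = (\<Sum>h\<in>(\<lambda>ms. hist ms v) ` G. x ^ receptions h)"
      by (simp add: sum.reindex)
    also have "\<dots> \<le> (\<Sum>h\<in>H. x ^ receptions h)"
    proof (rule sum_mono2)
      show "(\<lambda>ms. hist ms v) ` G \<subseteq> H"
        unfolding H_def hist_def using history_in_received_values[OF A] by blast
    qed (use \<open>finite H\<close> x in auto)
    finally show ?thesis unfolding H_def sum_power_receptions .
  qed
  have message: "card R * x powr (\<epsilon> * T) \<le> (\<Sum>v\<in>R. x ^ receptions (hist ms v))" for ms
  proof -
    \<comment> \<open>the tangent of \<open>t \<mapsto> x powr t\<close> at \<open>\<epsilon> * T\<close>\<close>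
    have tangent: "x powr (\<epsilon> * T) * (1 + (real r - \<epsilon> * T) * ln x) \<le> x ^ r" for r :: nat
    proof -
      have "x powr (\<epsilon> * T) * (1 + (real r - \<epsilon> * T) * ln x)
          \<le> x powr (\<epsilon> * T) * exp ((real r - \<epsilon> * T) * ln x)"
        by (intro mult_left_mono exp_ge_add_one_self) auto
      also have "\<dots> = x powr real r"
        using x by (simp add: powr_def exp_add[symmetric] algebra_simps)
      finally show ?thesis using x by (simp add: powr_realpow)
    qed
    have "(\<Sum>v\<in>R. real (receptions (hist ms v))) \<le> T * (\<epsilon> * card R)"
      unfolding hist_def using sum_receptions_le[OF R(1) hear] .
    \<comment> \<open>Since \<open>ln x \<le> 0\<close>, the upper bound on total receptions makes
      the linear terms of the tangents sum to a nonnegative number.\<close>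
    then have "((\<Sum>v\<in>R. real (receptions (hist ms v))) - T * (\<epsilon> * card R)) * ln x \<ge> 0"
      using x by (intro mult_nonpos_nonpos) auto
    then have "card R \<le> (\<Sum>v\<in>R. 1 + (real (receptions (hist ms v)) - \<epsilon> * T) * ln x)"
      unfolding sum.distrib sum_distrib_right[symmetric] sum_subtractf by (simp add: mult_ac)
    then have "x powr (\<epsilon> * T) * card R
        \<le> x powr (\<epsilon> * T) * (\<Sum>v\<in>R. 1 + (real (receptions (hist ms v)) - \<epsilon> * T) * ln x)"
      by (intro mult_left_mono) auto
    also have "\<dots> \<le> (\<Sum>v\<in>R. x ^ receptions (hist ms v))"
      unfolding sum_distrib_left by (intro sum_mono tangent)
    finally show ?thesis by (simp add: mult.commute)
  qed
  have "card G * (card R * x powr (\<epsilon> * T)) \<le> (\<Sum>ms\<in>G. \<Sum>v\<in>R. x ^ receptions (hist ms v))"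
    using sum_mono[of G "\<lambda>_. card R * x powr (\<epsilon> * T)"] message by simp
  also have "\<dots> = (\<Sum>v\<in>R. \<Sum>ms\<in>G. x ^ receptions (hist ms v))" by (rule sum.swap)
  also have "\<dots> \<le> card R * (1 + 2 ^ B * x) ^ T"
    using sum_mono[of R _ "\<lambda>_. (1 + 2 ^ B * x) ^ T"] leaf by simp
  finally have "card G * x powr (\<epsilon> * T) \<le> (1 + 2 ^ B * x) ^ T"
    using R by (simp add: mult.left_commute card_gt_0_iff)
  moreover have "x powr (\<epsilon> * T) = 1 / y powr (\<epsilon> * T)"
    using y unfolding x_def by (simp add: powr_divide)
  ultimately show ?thesis
    using y unfolding G_def x_def by (simp add: field_simps)
qed

text \<open>Averaging over the message lists: the expected number of delivered lists is at least
  half of all lists, yet each deterministic algorithm in the support obeys the counting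
  bound.\<close>

lemma broadcast_counting_bound:
  fixes y \<epsilon> :: real
  assumes solves: "solves_broadcast V E B b k T M"
    and R: "finite R" "R \<noteq> {}" "R \<subseteq> V" "src \<notin> R" and src: "src \<in> V"
    and hear: "\<And>X. real (card {v \<in> R. \<exists>!u. (u, v) \<in> E \<and> u \<in> X}) \<le> \<epsilon> * card R"
    and y: "y \<ge> 1"
  shows "2 ^ (b * k) \<le> 2 * (y powr (\<epsilon> * T) * (1 + 2 ^ B / y) ^ T)"
proof -
  interpret prob_space M using solves by (simp add: solves_broadcast_def)
  let ?D = "\<lambda>ms. {A \<in> space M. delivers V E T A (\<lambda>_. src) ms}"
  let ?K = "y powr (\<epsilon> * T) * (1 + 2 ^ B / y) ^ T"
  have half: "prob (?D ms) \<ge> 1/2" if "ms \<in> message_lists k b" for ms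
    using solves src that unfolding solves_broadcast_def by auto
  \<comment> \<open>A nonmeasurable event would have measure 0, contrary to
    \<open>half\<close>.\<close>
  have meas: "?D ms \<in> events" if "ms \<in> message_lists k b" for ms
    using half[OF that] measure_notin_sets[of "?D ms" M] by fastforce
  have "2 ^ (b * k) * (1/2) \<le> (\<Sum>ms\<in>message_lists k b. prob (?D ms))"
    using sum_mono[of "message_lists k b" "\<lambda>_. 1/2", OF half] by (simp add: card_message_lists)
  also have "\<dots> = (\<Sum>ms\<in>message_lists k b. expectation (indicator (?D ms)))"
    by (intro sum.cong) (auto simp: meas)
  also have "\<dots> = expectation (\<lambda>A. \<Sum>ms\<in>message_lists k b. indicator (?D ms) A)"
    by (subst Bochner_Integration.integral_sum) (auto simp: meas integrable_real_indicator less_top[symmetric])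
  also have "\<dots> \<le> expectation (\<lambda>A. ?K)"
  proof (rule integral_mono)
    show "integrable M (\<lambda>A. \<Sum>ms\<in>message_lists k b. indicator (?D ms) A :: real)"
      by (intro Bochner_Integration.integrable_sum) (auto simp: meas less_top[symmetric])
    fix A assume A: "A \<in> space M"
    have "(\<Sum>ms\<in>message_lists k b. indicator (?D ms) A :: real)
        = card {ms \<in> message_lists k b. delivers V E T A (\<lambda>_. src) ms}"
      using A by (simp add: indicator_def finite_message_lists Collect_conj_eq)
    also have "\<dots> \<le> ?K"
      using A solves by (intro card_delivered_le[OF _ R hear y]) (auto simp: solves_broadcast_def)
    finally show "(\<Sum>ms\<in>message_lists k b. indicator (?D ms) A) \<le> ?K" .
  qed simp
  also have "\<dots> = ?K" by (simp add: prob_space)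
  finally show ?thesis by simp
qed

section \<open>The lower bound\<close>

text \<open>The middle layer and the leaves occupy fewer than \<open>2 * 32 ^ d \<le> 64 ^ d\<close>
  vertices. The inequality is the logarithm of the counting bound.\<close>

lemma slow_broadcast_network:
  assumes d: "d \<ge> 1" "64 ^ d \<le> n"
  obtains V :: "nat set" and E where
    "radio_network V E" "card V = n" "graph_radius V E = 2"
    "\<And>B b k T M. solves_broadcast V E B b k T M \<Longrightarrow>
      real (b * k) * ln 2 \<le> ln 2 + T / d * (16 * (B * ln 2 + ln d) + 1)"
proof -
  obtain L :: "(nat \<times> int \<times> int) set" and nb :: "_ \<Rightarrow> nat set" where L: "finite L" "card L \<le> d * 16 ^ d"
      "d * 16 ^ d \<le> 2 * card L" "\<And>l. l \<in> L \<Longrightarrow> nb l \<noteq> {} \<and> nb l \<subseteq> {..<2 ^ d}"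
      "\<And>S. S \<subseteq> {..<2 ^ d} \<Longrightarrow> card {l \<in> L. card (nb l \<inter> S) = 1} \<le> 8 * 16 ^ d"
    by (rule sparse_unique_hitting_family[OF d(1)]) (rule that)
  have "0 < d * 16 ^ d" using d by simp
  then have "card L > 0" using L(3) by linarith
  then have "L \<noteq> {}" by auto
  have two: "(2::nat) \<le> 2 ^ d" using d(1) power_increasing[of 1 d "2::nat"] by simp
  have size: "2 ^ d + card L < n"
  proof -
    have "d * 16 ^ d \<le> 2 ^ d * 16 ^ d" by (intro mult_right_mono) (auto simp: less_imp_le)
    also have "\<dots> = (32::nat) ^ d" by (simp add: power_mult_distrib[symmetric])
    finally have "2 ^ d + card L \<le> 2 ^ d + 32 ^ d" using L(2) by linarith
    also have "2 ^ d < (32::nat) ^ d" using d(1) by (intro power_strict_mono) auto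
    also have "32 ^ d + 32 ^ d = 2 * (32::nat) ^ d" by simp
    also have "\<dots> \<le> 2 ^ d * 32 ^ d" using two by (intro mult_right_mono) auto
    also have "\<dots> = (64::nat) ^ d" by (simp add: power_mult_distrib[symmetric])
    finally show ?thesis using d(2) by simp
  qed
  obtain V :: "nat set" and E R src where net:
      "radio_network V E" "card V = n" "graph_radius V E = 2"
      and R: "R \<subseteq> V" "finite R" "card R = card L" "src \<in> V" "src \<notin> R"
      "\<And>X. card {v \<in> R. \<exists>!u. (u, v) \<in> E \<and> u \<in> X} \<le> 8 * 16 ^ d"
    by (rule radius_two_network_of_neighbourhoods[OF L(1) \<open>L \<noteq> {}\<close> L(4) two size L(5)];
        (assumption | rule that))
  show ?thesis
  proof
    fix B b k T M assume sol: "solves_broadcast V E B b k T M"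
    \<comment> \<open>This choice makes the factor \<open>(1 + 2 ^ B / y) ^ T\<close> at most
      \<open>exp (T / d)\<close>, while \<open>ln y\<close> exceeds \<open>B * ln 2\<close> only by
      \<open>ln d\<close>.\<close>
    define y :: real where "y = 2 ^ B * real d"
    have "y \<ge> 1 * 1" unfolding y_def using d by (intro mult_mono) auto
    then have y: "y \<ge> 1" by simp
    have frac: "real (card {v \<in> R. \<exists>!u. (u, v) \<in> E \<and> u \<in> X}) \<le> 16 / d * card R" for X
    proof -
      have "d * card {v \<in> R. \<exists>!u. (u, v) \<in> E \<and> u \<in> X} \<le> 16 * card R"
        using mult_le_mono2[OF R(6)[of X], of d] L(3) R(3) by linarith
      then have "real (d * card {v \<in> R. \<exists>!u. (u, v) \<in> E \<and> u \<in> X}) \<le> real (16 * card R)"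
        by (rule of_nat_mono)
      then show ?thesis using d by (simp add: field_simps)
    qed
    have "R \<noteq> {}" using R(3) \<open>card L > 0\<close> by auto
    have quot: "2 ^ B / y = 1 / d" by (simp add: y_def)
    have "(2::real) ^ (b * k) \<le> 2 * (y powr (16 / d * T) * (1 + 1 / d) ^ T)"
      using broadcast_counting_bound[OF sol R(2) \<open>R \<noteq> {}\<close> R(1,5,4) frac y] unfolding quot .
    then have "ln ((2::real) ^ (b * k)) \<le> ln (2 * (y powr (16 / d * T) * (1 + 1 / d) ^ T))"
      by (subst ln_le_cancel_iff) (use y in \<open>auto intro!: mult_pos_pos zero_less_power add_pos_nonneg\<close>)
    also have "\<dots> = ln 2 + (16 / d * T * ln y + T * ln (1 + 1 / d))"
    proof -
      have "0 < 1 + 1 / real d" by (simp add: add_pos_nonneg)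
      then show ?thesis using y by (simp add: ln_mult ln_powr ln_realpow)
    qed
    also have "\<dots> \<le> ln 2 + (16 / d * T * ln y + T * (1 / d))"
      by (intro add_left_mono mult_left_mono ln_add_one_self_le_self) auto
    also have "ln y = B * ln 2 + ln d"
      unfolding y_def using d by (simp add: ln_mult ln_realpow)
    finally show "real (b * k) * ln 2 \<le> ln 2 + T / d * (16 * (B * ln 2 + ln d) + 1)"
      by (simp add: ln_realpow algebra_simps add_divide_distrib)
  qed (fact net)+
qed

theorem theorem1:
  fixes B b :: "nat \<Rightarrow> nat"
  assumes packet_bits: "(\<lambda>n. real (B n)) \<in> \<Omega>(\<lambda>n. ln (real n))"
    and message_bits: "(\<lambda>n. real (b n)) \<in> \<Theta>(\<lambda>n. real (B n))"
  shows "\<exists>c::real. c > 0 \<and> (\<exists>N. \<forall>n\<ge>N.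
    \<exists>(V::nat set) E. radio_network V E \<and> card V = n \<and> graph_radius V E = 2 \<and>
      (\<forall>k\<ge>1. \<forall>T M. solves_broadcast V E (B n) (b n) k T M \<longrightarrow>
         real T \<ge> c * real k * ln (real n)))"
proof -
  obtain \<beta> where \<beta>: "\<beta> > 0" "\<forall>\<^sub>F n in sequentially. real (B n) \<ge> \<beta> * \<bar>ln (real n)\<bar>"
    using packet_bits by (elim landau_omega.bigE) auto
  obtain \<gamma> where \<gamma>: "\<gamma> > 0" "\<forall>\<^sub>F n in sequentially. real (b n) \<ge> \<gamma> * real (B n)"
    using bigthetaD2[OF message_bits] by (elim landau_omega.bigE) auto
  have "filterlim (\<lambda>n. ln (real n)) at_top sequentially"
    by (rule filterlim_compose[OF ln_at_top filterlim_real_sequentially])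
  \<comment> \<open>The threshold will force \<open>b n \<ge> 2\<close>; then halving
    \<open>b n * k\<close> absorbs the additive \<open>ln 2\<close> that comes from the success
    probability \<open>1/2\<close>.\<close>
  then have "\<forall>\<^sub>F n in sequentially. ln (real n) \<ge> 2 / (\<gamma> * \<beta>)"
    by (simp add: filterlim_at_top)
  then have "\<forall>\<^sub>F n in sequentially. n \<ge> 64 \<and> ln (real n) \<ge> 2 / (\<gamma> * \<beta>)
      \<and> real (B n) \<ge> \<beta> * \<bar>ln (real n)\<bar> \<and> real (b n) \<ge> \<gamma> * real (B n)"
    using \<beta>(2) \<gamma>(2) eventually_ge_at_top[of 64] by eventually_elim auto
  then obtain N where N: "\<And>n. n \<ge> N \<Longrightarrow> n \<ge> 64 \<and> ln (real n) \<ge> 2 / (\<gamma> * \<beta>)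
      \<and> real (B n) \<ge> \<beta> * \<bar>ln (real n)\<bar> \<and> real (b n) \<ge> \<gamma> * real (B n)"
    unfolding eventually_sequentially by blast
  \<comment> \<open>\<open>K\<close> bounds the cost per packet bit: \<open>ln d\<close> and the
    additive 1 are both at most \<open>ln n\<close>, hence at most
    \<open>B n / \<beta>\<close>.\<close>
  define K where "K = 16 + 17 / \<beta>"
  \<comment> \<open>One factor 2 in the denominator comes from halving \<open>b n * k\<close>, and
    \<open>2 * ln 64\<close> from replacing \<open>d\<close> by \<open>ln n\<close>.\<close>
  define c where "c = \<gamma> * ln 2 / (4 * K * ln 64)"
  have "K > 0" using \<beta> by (simp add: K_def add_pos_pos)
  have "c > 0" using \<gamma> \<open>K > 0\<close> by (simp add: c_def)
  have "\<exists>(V::nat set) E. radio_network V E \<and> card V = n \<and> graph_radius V E = 2 \<and>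
      (\<forall>k\<ge>1. \<forall>T M. solves_broadcast V E (B n) (b n) k T M \<longrightarrow>
         real T \<ge> c * real k * ln (real n))" if "n \<ge> N" for n
  proof -
    define X where "X = ln (real n)"
    have n64: "n \<ge> 64" using N[OF that] by simp
    \<comment> \<open>The largest \<open>d\<close> with enough room; it satisfies
      \<open>d \<le> ln n \<le> 2 * d * ln 64\<close>.\<close>
    then obtain d where d: "64 ^ d \<le> n" "n < 64 ^ (d + 1)"
      using ex_power_ivl1[of 64 n] by auto
    have "d \<ge> 1" using d n64 by (cases d) auto
    have ln64: "ln (64::real) \<ge> 1"
      using ln_ge_iff[of 64 1] exp_le by simp
    have "X \<ge> ln 64" unfolding X_def using n64 by simp
    then have "X \<ge> 1" using ln64 by simp
    have "real (64 ^ d) \<le> real n" using d by (intro of_nat_mono)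
    then have "ln (64 ^ d) \<le> X" unfolding X_def using n64 by (subst ln_le_cancel_iff) auto
    then have "d * ln 64 \<le> X" by (simp add: ln_realpow)
    moreover have "real d * 1 \<le> d * ln (64::real)" using ln64 by (intro mult_left_mono) auto
    ultimately have dX: "d \<le> X" by simp
    have "real n \<le> real (64 ^ (d + 1))" using d by (intro of_nat_mono) simp
    then have "X \<le> ln (64 ^ (d + 1))" unfolding X_def using n64 by (subst ln_le_cancel_iff) auto
    also have "\<dots> = (d + 1) * ln 64" by (simp only: ln_realpow)
    also have "\<dots> \<le> (2 * d) * ln 64" using \<open>d \<ge> 1\<close> by (intro mult_right_mono) auto
    finally have Xd: "X \<le> 2 * d * ln 64" by simp
    have B: "B n \<ge> \<beta> * X" using N[OF that] \<open>X \<ge> 1\<close> unfolding X_def by simp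
    then have XB: "X \<le> B n / \<beta>" using \<beta> by (simp add: field_simps)
    have "\<beta> * X > 0" using \<beta> \<open>X \<ge> 1\<close> by simp
    then have Bpos: "real (B n) > 0" using B by linarith
    have b: "b n \<ge> \<gamma> * B n" using N[OF that] by simp
    have "2 \<le> \<gamma> * (\<beta> * X)"
      using N[OF that] \<beta> \<gamma> unfolding X_def by (simp add: field_simps)
    also have "\<dots> \<le> \<gamma> * B n" using B \<gamma> by (intro mult_left_mono) auto
    finally have b2: "b n \<ge> 2" using b by linarith
    have cost: "16 * (B n * ln 2 + ln d) + 1 \<le> B n * K"
    proof -
      have "B n * ln 2 \<le> real (B n) * 1" using ln_2_less_1 by (intro mult_left_mono) auto
      moreover have "ln d \<le> X" using ln_le_minus_one[of "real d"] \<open>d \<ge> 1\<close> dX by simp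
      ultimately have "16 * (B n * ln 2 + ln d) + 1 \<le> 16 * (B n + X) + X"
        using \<open>X \<ge> 1\<close> by simp
      also have "\<dots> \<le> 16 * B n + 17 * (B n / \<beta>)" using XB by simp
      finally show ?thesis by (simp add: K_def algebra_simps)
    qed
    obtain V :: "nat set" and E where net:
        "radio_network V E" "card V = n" "graph_radius V E = 2"
      and slow: "\<And>B b k T M. solves_broadcast V E B b k T M \<Longrightarrow>
        real (b * k) * ln 2 \<le> ln 2 + T / d * (16 * (B * ln 2 + ln d) + 1)"
      by (rule slow_broadcast_network[OF \<open>d \<ge> 1\<close> d(1)]) (rule that)
    have "real T \<ge> c * real k * X"
      if k: "k \<ge> 1" and sol: "solves_broadcast V E (B n) (b n) k T M" for k T M
    proof -
      have "2 * 1 \<le> b n * k" using b2 k by (intro mult_le_mono)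
      then have "real (b n * k) \<ge> 2" by linarith
      then have "real (b n * k) / 2 * ln 2 \<le> (real (b n * k) - 1) * ln 2"
        by (intro mult_right_mono) (linarith | simp)+
      also have "\<dots> \<le> T / d * (16 * (B n * ln 2 + ln d) + 1)"
        using slow[OF sol] by (simp add: algebra_simps)
      also have "\<dots> \<le> T / d * (B n * K)" using cost by (intro mult_left_mono) auto
      finally have "real (b n) * (k / 2 * ln 2) \<le> T / d * (B n * K)" by (simp add: mult_ac)
      moreover have "\<gamma> * B n * (k / 2 * ln 2) \<le> b n * (k / 2 * ln 2)"
        using b by (intro mult_right_mono) auto
      \<comment> \<open>Message size and cost both scale with \<open>B n\<close>, which therefore
        cancels.\<close>
      ultimately have "B n * (\<gamma> * (k / 2 * ln 2)) \<le> B n * (T / d * K)"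
        by (simp add: mult_ac)
      then have "\<gamma> * (k / 2 * ln 2) \<le> T / d * K"
        using Bpos by (simp only: mult_le_cancel_left_pos)
      then have T: "\<gamma> * k * ln 2 * d \<le> 2 * T * K"
        using \<open>d \<ge> 1\<close> by (simp add: field_simps)
      have "c * k * X \<le> c * k * (2 * d * ln 64)"
        using Xd \<open>c > 0\<close> by (intro mult_left_mono) auto
      also have "\<dots> = \<gamma> * k * ln 2 * d / (2 * K)"
        using ln64 \<open>K > 0\<close> by (simp add: c_def field_simps)
      also have "\<dots> \<le> T" using T \<open>K > 0\<close> by (simp add: field_simps)
      finally show ?thesis .
    qed
    then show ?thesis using net unfolding X_def by blast
  qed
  then show ?thesis using \<open>c > 0\<close> by blast
qed

end
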